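(* Let $q=p^{\alpha}$ with $p$ an odd prime, $\alpha$ a positive integer and $q\equiv 1\pmod 4$, let $k$ be the integer with $q=2k-1$, and let $\omega_{0}$ be a complex number of modulus one with $\Re(\omega_{0}^{2})=\frac{2-k}{k-1}$. The complex symmetric matrix $C=C(\omega_{0})$ of order $2k-1$ satisfies $$CC^{*}=(2k-2)I.$$
   Context: $GF(q)$ is the finite field with $q$ elements, and $\varkappa: GF(q)\to\{-1,0,1\}$ is the Legendre symbol: $\varkappa(0)=0$, and for $x\neq 0$, $\varkappa(x)=1$ if $x$ is a square in $GF(q)$ and $\varkappa(x)=-1$ otherwise. Let $a_{1},\dots,a_{q}$ be an enumeration of the elements of $GF(q)$. For a complex number $\omega$ of modulus one, $C(\omega)=(c_{\alpha\beta})$ is the $q\times q$ complex matrix with $c_{\alpha\alpha}=0$ for $\alpha=1,\dots,q$, and $c_{\alpha\beta}=\omega^{\varkappa(a_{\alpha}-a_{\beta})}$ for $\alpha\neq\beta$, $\alpha,\beta=1,\dots,q$. $I$ is the identity matrix of order $q$, $C^{*}$ is the adjoint (conjugate transpose) of $C$, and $\Re$ denotes the real part. (A complex $n\times n$ matrix $C=(c_{ij})$ with $c_{ii}=0$, $|c_{ij}|=1$ for $i\neq j$, and $CC^{*}=(n-1)I_{n}$ is called a complex conference matrix.) *)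

theory Defs
  imports Complex_Main "HOL-Computational_Algebra.Primes" "Jordan_Normal_Form.Schur_Decomposition"
begin

definition legendre_symbol :: "'a::{field,finite} \<Rightarrow> int" where
  "legendre_symbol x = (if x = 0 then 0 else if \<exists>y. x = y ^ 2 then 1 else -1)"

(* The enumeration a lists the field elements as a 0, ..., a (q - 1), since matrix
   indices of type mat start at 0; only these values of a are used. *)
definition legendre_mat :: "(nat \<Rightarrow> 'a::{field,finite}) \<Rightarrow> complex \<Rightarrow> complex mat" where
  "legendre_mat a \<omega> = mat (card (UNIV :: 'a set)) (card (UNIV :: 'a set))
     (\<lambda>(i, j). if i = j then 0 else \<omega> powi legendre_symbol (a i - a j))"

end

theory Submission
  imports Defs
begin

text \<open>
  For \<open>|\<omega>| = 1\<close> and \<open>\<omega> = x + \<i> y\<close>, one has \<open>\<omega>\<^sup>u = x u\<^sup>2 + \<i> y u\<close> for \<open>u = \<plusminus>1\<close>, and the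
  right-hand side also gives the zero diagonal at \<open>u = 0\<close>. With \<open>\<chi>\<close> the Legendre symbol, the
  entries of \<open>C C\<^sup>*\<close> thus reduce to the sums of \<open>\<chi>(c)\<^sup>i \<chi>(c + d)\<^sup>j\<close> over \<open>c\<close> for
  \<open>i, j \<in> {1, 2}\<close>. For \<open>d \<noteq> 0\<close>, \<open>\<chi>(-1) = 1\<close> makes the imaginary part vanish, the sum of
  \<open>\<chi>(c) \<chi>(c + d)\<close> is \<open>-1\<close>, and the off-diagonal entries equal \<open>(q - 2) x\<^sup>2 - y\<^sup>2\<close>,
  which the choice of \<open>\<omega>\<close> makes zero.
\<close>

section \<open>Parity arguments by involutions without fixed points\<close>

lemma even_card_involution:
  assumes "finite A" and "\<And>x. x \<in> A \<Longrightarrow> f x \<in> A" and "\<And>x. x \<in> A \<Longrightarrow> f (f x) = x"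
    and "\<And>x. x \<in> A \<Longrightarrow> f x \<noteq> x"
  shows "even (card A)"
  using assms
proof (induction A rule: finite_psubset_induct)
  case (psubset A)
  show ?case
  proof (cases "A = {}")
    case False
    then obtain x where x: "x \<in> A" by blast
    let ?B = "A - {x, f x}"
    have "even (card ?B)"
    proof (rule psubset.IH)
      show "?B \<subset> A" using x by blast
      show "f y \<in> ?B" if "y \<in> ?B" for y
        using that psubset.prems x by (metis Diff_iff insert_iff empty_iff)
    qed (use psubset.prems in auto)
    moreover have "card ?B = card A - card {x, f x}"
      using x psubset.prems by (intro card_Diff_subset) auto
    moreover have "card {x, f x} = 2" using psubset.prems(3)[OF x] by simp
    moreover have "card {x, f x} \<le> card A"
      using x psubset.prems psubset.hyps by (intro card_mono) auto
    ultimately show ?thesis by simp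
  qed simp
qed

text \<open>In characteristic 2, translation by 1 would be a fixed-point-free involution of the
  field, so its order would be even.\<close>

lemma two_neq_zero_of_odd_card:
  assumes "odd (card (UNIV :: 'a::{field,finite} set))"
  shows "(2::'a) \<noteq> 0"
proof
  assume "(2::'a) = 0"
  then have "x + 1 + 1 = x" for x :: 'a by (simp add: add.assoc)
  then have "even (card (UNIV :: 'a set))"
    by (intro even_card_involution[where f = "\<lambda>x. x + 1"]) auto
  with assms show False by simp
qed

section \<open>Nonzero squares and multiplicativity of the Legendre symbol\<close>

definition nonzero_squares :: "'a::{field,finite} set" where
  "nonzero_squares = (\<lambda>y. y\<^sup>2) ` (UNIV - {0})"

lemma legendre_symbol_altdef:
  "legendre_symbol x = (if x = 0 then 0 else if x \<in> nonzero_squares then 1 else -1)"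
  unfolding legendre_symbol_def nonzero_squares_def by auto

lemma nonzero_squares_mult:
  "x \<in> nonzero_squares \<Longrightarrow> y \<in> nonzero_squares \<Longrightarrow> x * y \<in> nonzero_squares"
  unfolding nonzero_squares_def
  by (auto simp: image_iff power_mult_distrib intro!: bexI[where x = "_ * _"])

lemma nonzero_squares_inverse:
  "x \<in> nonzero_squares \<Longrightarrow> inverse x \<in> nonzero_squares"
  unfolding nonzero_squares_def
  by (auto simp: image_iff power_inverse intro!: bexI[where x = "inverse _"])

lemma zero_notin_nonzero_squares [simp]: "0 \<notin> nonzero_squares"
  by (auto simp: nonzero_squares_def)

lemma one_in_nonzero_squares [simp]: "1 \<in> nonzero_squares"
  unfolding nonzero_squares_def by (rule image_eqI[where x = 1]) auto

text \<open>Squaring is two-to-one on the nonzero elements: its fibers are {z, -z}, and z differs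
  from -z because 2 is invertible.\<close>

lemma card_nonzero_squares:
  assumes "(2::'a::{field,finite}) \<noteq> 0"
  shows "card (UNIV :: 'a set) = 2 * card (nonzero_squares :: 'a set) + 1"
proof -
  let ?N = "UNIV - {0::'a}" and ?S = "nonzero_squares :: 'a set"
  have fiber: "card {y \<in> ?N. y\<^sup>2 = s} = 2" if "s \<in> ?S" for s
  proof -
    from that obtain z where z: "z \<noteq> 0" "s = z\<^sup>2" by (auto simp: nonzero_squares_def)
    have "z \<noteq> - z"
    proof
      assume "z = - z"
      then have "z + z = 0" by (simp add: eq_neg_iff_add_eq_0)
      then have "2 * z = 0" by (simp only: mult_2)
      with z assms show False by simp
    qed
    moreover have "{y \<in> ?N. y\<^sup>2 = s} = {z, - z}" using z by (auto simp: power2_eq_iff)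
    ultimately show ?thesis by simp
  qed
  have "card ?N = (\<Sum>s\<in>?S. \<Sum>y\<in>{y \<in> ?N. y\<^sup>2 = s}. 1)"
    by (subst sum.group) (auto simp: nonzero_squares_def)
  also have "\<dots> = 2 * card ?S" using fiber by simp
  finally have "card ?N = 2 * card ?S" .
  moreover have "card (UNIV :: 'a set) = card ?N + 1"
    by (metis card_Suc_Diff1 finite UNIV_I Suc_eq_plus1)
  ultimately show ?thesis by (simp only:)
qed

text \<open>Multiplication by the nonsquare x injects the nonzero squares into the nonsquares. Both
  sets have (q - 1) / 2 elements, so this is onto; hence y = x * s with s a square, and x * y = x^2
  * s.\<close>

lemma nonsquare_mult_nonsquare:
  fixes x y :: "'a::{field,finite}"
  assumes "(2::'a) \<noteq> 0" and "x \<noteq> 0" "x \<notin> nonzero_squares" and "y \<noteq> 0" "y \<notin> nonzero_squares"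
  shows "x * y \<in> nonzero_squares"
proof -
  let ?N = "UNIV - {0::'a}" and ?S = "nonzero_squares :: 'a set"
  have "(*) x ` ?S \<subseteq> ?N - ?S"
  proof clarify
    fix s assume s: "s \<in> ?S"
    have "x * s \<notin> ?S"
    proof
      assume "x * s \<in> ?S"
      then have "x * s * inverse s \<in> ?S" using s nonzero_squares_mult nonzero_squares_inverse by blast
      moreover have "s \<noteq> 0" using s by auto
      ultimately show False using assms by (simp add: mult.assoc)
    qed
    then show "x * s \<in> ?N - ?S" using assms s by auto
  qed
  moreover have "card ((*) x ` ?S) = card ?S"
    using assms by (intro card_image) (auto simp: inj_on_def)
  moreover have "card (?N - ?S) = card ?S"
  proof -
    have "card (?N - ?S) = card ?N - card ?S"
      by (intro card_Diff_subset) (auto intro!: finite_subset[OF subset_UNIV] simp: nonzero_squares_def)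
    then show ?thesis using card_nonzero_squares[OF assms(1)] by (simp add: card_Diff_singleton)
  qed
  ultimately have "(*) x ` ?S = ?N - ?S" by (intro card_subset_eq) auto
  then obtain s where "s \<in> ?S" "y = x * s" using assms by blast
  then have "x * y = x\<^sup>2 * s" by (simp add: power2_eq_square)
  moreover have "x\<^sup>2 \<in> ?S" using assms by (auto simp: nonzero_squares_def)
  ultimately show ?thesis using \<open>s \<in> ?S\<close> nonzero_squares_mult by metis
qed

lemma legendre_symbol_mult:
  fixes x y :: "'a::{field,finite}"
  assumes "(2::'a) \<noteq> 0"
  shows "legendre_symbol (x * y) = legendre_symbol x * legendre_symbol y"
proof -
  have *: "x * y \<notin> nonzero_squares" if "x \<in> nonzero_squares" "y \<notin> nonzero_squares" for x y :: 'a
  proof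
    assume "x * y \<in> nonzero_squares"
    then have "inverse x * (x * y) \<in> nonzero_squares"
      using that nonzero_squares_mult nonzero_squares_inverse by blast
    moreover have "x \<noteq> 0" using that by auto
    ultimately show False using that by (simp flip: mult.assoc)
  qed
  show ?thesis
    using nonzero_squares_mult[of x y] nonsquare_mult_nonsquare[OF assms, of x y] *[of x y] *[of y x]
    by (auto simp: legendre_symbol_altdef mult.commute)
qed

lemma legendre_symbol_0 [simp]: "legendre_symbol 0 = 0"
  and legendre_symbol_1 [simp]: "legendre_symbol 1 = 1"
  by (simp_all add: legendre_symbol_altdef)

lemma legendre_symbol_square:
  "legendre_symbol x * legendre_symbol x = (if x = 0 then 0 else 1)"
  by (simp add: legendre_symbol_altdef)

text \<open>The point is that -1 is a square. The number (q - 1) / 2 of nonzero squares is even, so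
  removing 1 leaves an odd number. Inversion permutes the remaining ones and can fix only -1; if -1
  were not among them, their number would be even.\<close>

lemma legendre_symbol_minus:
  fixes x :: "'a::{field,finite}"
  assumes "card (UNIV :: 'a set) mod 4 = 1"
  shows "legendre_symbol (- x) = legendre_symbol x"
proof -
  let ?S = "nonzero_squares :: 'a set"
  have two: "(2::'a) \<noteq> 0" using assms by (intro two_neq_zero_of_odd_card) presburger
  have "even (card ?S)" using card_nonzero_squares[OF two] assms by presburger
  moreover have "card ?S = Suc (card (?S - {1}))" by (intro card_Suc_Diff1[symmetric]) auto
  ultimately have odd: "odd (card (?S - {1}))" by (metis even_Suc)
  have "- 1 \<in> ?S"
  proof (rule ccontr)
    assume neg: "- 1 \<notin> ?S"
    have "even (card (?S - {1}))"
    proof (rule even_card_involution[where f = inverse])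
      show "inverse s \<noteq> s" if "s \<in> ?S - {1}" for s
      proof
        assume "inverse s = s"
        moreover have "s \<noteq> 0" using that by auto
        ultimately have "s * s = 1" by (metis right_inverse)
        then have "s = 1 \<or> s = - 1" by (simp add: square_eq_1_iff)
        with that neg show False by auto
      qed
    qed (auto intro: nonzero_squares_inverse)
    with odd show False by simp
  qed
  then have "legendre_symbol (- 1 :: 'a) = 1" by (simp add: legendre_symbol_altdef)
  then show ?thesis using legendre_symbol_mult[OF two, of "- 1" x] by simp
qed

section \<open>Character sums\<close>

lemma sum_legendre_symbol:
  assumes "(2::'a::{field,finite}) \<noteq> 0"
  shows "(\<Sum>x\<in>UNIV. legendre_symbol (x::'a)) = 0"
proof -
  let ?S = "nonzero_squares :: 'a set"
  \<comment> \<open>The term 2 * [x in S] - 1 is the symbol away from 0; the last summand corrects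
    its value -1 at 0.\<close>
  have "(\<Sum>x\<in>UNIV. legendre_symbol (x::'a))
      = (\<Sum>x\<in>UNIV. 2 * (if x \<in> ?S then 1 else 0) - 1 + (if x = 0 then 1 else 0))"
    by (intro sum.cong) (auto simp: legendre_symbol_altdef)
  also have "\<dots> = 2 * int (card ?S) - int (card (UNIV :: 'a set)) + 1"
    by (simp add: sum.distrib sum_subtractf sum.If_cases flip: sum_distrib_left)
  finally show ?thesis using card_nonzero_squares[OF assms] by simp
qed

lemma sum_legendre_symbol_shift:
  assumes "(2::'a::{field,finite}) \<noteq> 0"
  shows "(\<Sum>x\<in>UNIV. legendre_symbol (x + d :: 'a)) = 0"
  using sum_legendre_symbol[OF assms]
    sum.reindex_bij_witness[of UNIV "\<lambda>x. x - d" "\<lambda>x. x + d" UNIV legendre_symbol "\<lambda>x. legendre_symbol (x + d)"]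
  by simp

text \<open>For nonzero c, pulling a factor c out of c + d leaves the symbol of 1 + d / c, since the
  symbol of c squares to 1. As c runs over the nonzero elements, 1 + d / c takes every value except
  1, so the full sum 0 loses only the term 1.\<close>

lemma sum_legendre_symbol_mult_shift:
  fixes d :: "'a::{field,finite}"
  assumes "(2::'a) \<noteq> 0" and "d \<noteq> 0"
  shows "(\<Sum>c\<in>UNIV. legendre_symbol c * legendre_symbol (c + d)) = - 1"
proof -
  have "(\<Sum>c\<in>UNIV. legendre_symbol c * legendre_symbol (c + d))
      = (\<Sum>c\<in>UNIV - {0}. legendre_symbol c * legendre_symbol (c + d))"
    by (intro sum.mono_neutral_right) auto
  also have "\<dots> = (\<Sum>c\<in>UNIV - {0}. legendre_symbol (1 + d / c))"
  proof (rule sum.cong)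
    fix c :: 'a assume "c \<in> UNIV - {0}"
    then have c: "c \<noteq> 0" by simp
    then have "c + d = c * (1 + d / c)" by (simp add: field_simps)
    then have "legendre_symbol (c + d) = legendre_symbol c * legendre_symbol (1 + d / c)"
      by (simp only: legendre_symbol_mult[OF assms(1)])
    then show "legendre_symbol c * legendre_symbol (c + d) = legendre_symbol (1 + d / c)"
      using legendre_symbol_square[of c] c by (simp flip: mult.assoc)
  qed simp
  also have "\<dots> = (\<Sum>e\<in>UNIV - {1::'a}. legendre_symbol e)"
    by (rule sum.reindex_bij_witness[where i = "\<lambda>e. d / (e - 1)" and j = "\<lambda>c. 1 + d / c"])
      (auto simp: assms(2))
  also have "\<dots> = - 1"
    using sum_legendre_symbol[OF assms(1)] by (simp add: sum_diff1)
  finally show ?thesis .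
qed

section \<open>Matrix entries and inner products of rows\<close>

lemma powi_legendre_symbol:
  assumes "cmod \<omega> = 1" and "x \<noteq> 0"
  shows "\<omega> powi legendre_symbol x
    = Re \<omega> * of_int (legendre_symbol x)^2 + \<i> * Im \<omega> * of_int (legendre_symbol x)"
proof -
  have "inverse \<omega> = cnj \<omega>"
    using assms(1) by (simp add: complex_eq_iff cmod_def)
  \<comment> \<open>At x = 0 the formula would fail: the power is 1 there, the right-hand side
    0.\<close>
  then show ?thesis using assms(2)
    by (simp add: legendre_symbol_def complex_eq_iff)
qed

text \<open>The inner product of the rows of \<open>legendre_mat\<close> for \<open>s\<close> and \<open>s + d\<close>, after the
  substitution of \<open>s - c\<close> for the column element.\<close>

lemma sum_legendre_rows:
  fixes d :: "'a::{field,finite}" and x y :: real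
  assumes q: "card (UNIV :: 'a set) mod 4 = 1"
  defines "g \<equiv> \<lambda>c::'a. x * of_int (legendre_symbol c)^2 + \<i> * y * of_int (legendre_symbol c)"
  shows "(\<Sum>c\<in>UNIV. g c * cnj (g (c + d)))
    = (if d = 0 then (real (card (UNIV :: 'a set)) - 1) * (x\<^sup>2 + y\<^sup>2)
       else (real (card (UNIV :: 'a set)) - 2) * x\<^sup>2 - y\<^sup>2)"
proof -
  let ?l = "legendre_symbol :: 'a \<Rightarrow> int" and ?q = "card (UNIV :: 'a set)"
  have two: "(2::'a) \<noteq> 0" using q by (intro two_neq_zero_of_odd_card) presburger
  \<comment> \<open>With A, B the symbols of c and c + d, each summand is x^2 A^2 B^2 + y^2 A B + i
    x y (A B^2 - A^2 B).\<close>
  have "(\<Sum>c\<in>UNIV. g c * cnj (g (c + d)))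
    = (\<Sum>c\<in>UNIV. complex_of_real (x\<^sup>2) * of_int ((?l c * ?l c) * (?l (c + d) * ?l (c + d)))
        + complex_of_real (y\<^sup>2) * of_int (?l c * ?l (c + d))
        + \<i> * complex_of_real (x * y) * of_int (?l c * (?l (c + d) * ?l (c + d)) - (?l c * ?l c) * ?l (c + d)))"
    by (intro sum.cong) (auto simp: g_def algebra_simps power2_eq_square)
  also have "\<dots> = complex_of_real (x\<^sup>2) * of_int (\<Sum>c\<in>UNIV. (?l c * ?l c) * (?l (c + d) * ?l (c + d)))
        + complex_of_real (y\<^sup>2) * of_int (\<Sum>c\<in>UNIV. ?l c * ?l (c + d))
        + \<i> * complex_of_real (x * y) * of_int ((\<Sum>c\<in>UNIV. ?l c * (?l (c + d) * ?l (c + d)))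
                                 - (\<Sum>c\<in>UNIV. (?l c * ?l c) * ?l (c + d)))"
    by (simp only: sum.distrib sum_distrib_left sum_subtractf of_int_sum of_int_diff right_diff_distrib)
  finally have eq: "(\<Sum>c\<in>UNIV. g c * cnj (g (c + d))) = \<dots>" .
  have square: "?l c * ?l c = 1 - (if c = 0 then 1 else 0)" for c
    by (simp add: legendre_symbol_square)
  have count: "(\<Sum>c\<in>UNIV. ?l c * ?l c) = int ?q - 1"
    by (simp add: square sum_subtractf)
  show ?thesis
  proof (cases "d = 0")
    case True
    have "(\<Sum>c\<in>UNIV. (?l c * ?l c) * (?l c * ?l c)) = int ?q - 1"
      unfolding count[symmetric] by (intro sum.cong) (simp_all add: legendre_symbol_square)
    then show ?thesis unfolding eq
      by (simp only: True add_0_right count) (simp add: algebra_simps)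
  next
    case False
    have square_shift: "(?l (c + d) * ?l (c + d)) = 1 - (if c = - d then 1 else 0)" for c
      by (simp add: legendre_symbol_square add_eq_0_iff2)
    \<comment> \<open>Exactly the two distinct elements 0 and -d contribute nothing.\<close>
    have "(\<Sum>c\<in>UNIV. (?l c * ?l c) * (?l (c + d) * ?l (c + d)))
        = (\<Sum>c\<in>UNIV. ?l c * ?l c - (if c = - d then 1 else 0))"
      using False by (intro sum.cong) (simp_all add: square_shift legendre_symbol_square eq_neg_iff_add_eq_0)
    then have a: "(\<Sum>c\<in>UNIV. (?l c * ?l c) * (?l (c + d) * ?l (c + d))) = int ?q - 2"
      by (simp add: sum_subtractf count)
    \<comment> \<open>The square factor merely deletes one term from a complete sum equal to 0: the
      term at -d here, the term at 0 in the sum after it. Both results are minus the symbol of d, so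
      the imaginary part cancels.\<close>
    have "(\<Sum>c\<in>UNIV. ?l c * (?l (c + d) * ?l (c + d)))
        = (\<Sum>c\<in>UNIV. ?l c - (if c = - d then ?l (- d) else 0))"
      by (intro sum.cong) (simp_all add: square_shift)
    then have b: "(\<Sum>c\<in>UNIV. ?l c * (?l (c + d) * ?l (c + d))) = - ?l d"
      by (simp add: sum_subtractf sum_legendre_symbol[OF two] legendre_symbol_minus[OF q])
    have "(\<Sum>c\<in>UNIV. (?l c * ?l c) * ?l (c + d))
        = (\<Sum>c\<in>UNIV. ?l (c + d) - (if c = 0 then ?l d else 0))"
      by (intro sum.cong) (simp_all add: square)
    then have c: "(\<Sum>c\<in>UNIV. (?l c * ?l c) * ?l (c + d)) = - ?l d"
      by (simp add: sum_subtractf sum_legendre_symbol_shift[OF two])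
    show ?thesis
      unfolding eq a b c sum_legendre_symbol_mult_shift[OF two False] using False
      by (simp add: algebra_simps)
  qed
qed

lemma mat_adjoint_index:
  "i < dim_col A \<Longrightarrow> j < dim_row A \<Longrightarrow> mat_adjoint A $$ (i, j) = conjugate (A $$ (j, i))"
  by (simp add: mat_adjoint_def mat_of_rows_index)

theorem corollary3:
  fixes p \<alpha> q :: nat
    and k :: int
    and a :: "nat \<Rightarrow> 'a::{field,finite}"
    and \<omega>\<^sub>0 :: complex
  assumes "prime p" and "odd p" and "\<alpha> > 0"
    and "q = p ^ \<alpha>" and "q mod 4 = 1"
    and "card (UNIV :: 'a set) = q"
    and "bij_betw a {0..<q} (UNIV :: 'a set)"
    and "int q = 2 * k - 1"
    and "cmod \<omega>\<^sub>0 = 1"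
    and "Re (\<omega>\<^sub>0 ^ 2) = (2 - of_int k) / (of_int k - 1)"
  shows "legendre_mat a \<omega>\<^sub>0 \<in> carrier_mat (nat (2 * k - 1)) (nat (2 * k - 1)) \<and>
    transpose_mat (legendre_mat a \<omega>\<^sub>0) = legendre_mat a \<omega>\<^sub>0 \<and>
    legendre_mat a \<omega>\<^sub>0 * mat_adjoint (legendre_mat a \<omega>\<^sub>0)
      = of_int (2 * k - 2) \<cdot>\<^sub>m 1\<^sub>m (nat (2 * k - 1))"
proof -
  let ?C = "legendre_mat a \<omega>\<^sub>0" and ?l = "legendre_symbol :: 'a \<Rightarrow> int"
  let ?x = "Re \<omega>\<^sub>0" and ?y = "Im \<omega>\<^sub>0"
  define g where "g = (\<lambda>c::'a. ?x * of_int (?l c)^2 + \<i> * ?y * of_int (?l c))"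
  have qk: "nat (2 * k - 1) = q" using assms(8) by simp
  have q4: "card (UNIV :: 'a set) mod 4 = 1" using assms(5,6) by simp
  have inj: "i = j" if "a i = a j" "i < q" "j < q" for i j
    using that assms(7) by (auto simp: bij_betw_def inj_on_def)
  have car: "?C \<in> carrier_mat q q" by (simp add: legendre_mat_def assms(6))
  have entry: "?C $$ (i, j) = g (a i - a j)" if "i < q" "j < q" for i j
  proof (cases "i = j")
    case False
    then have "a i - a j \<noteq> 0" using inj[OF _ that] by auto
    then show ?thesis using that False
      by (simp add: legendre_mat_def assms(6) g_def powi_legendre_symbol[OF assms(9)])
  qed (use that in \<open>simp add: legendre_mat_def assms(6) g_def\<close>)
  \<comment> \<open>Evenness of \<open>g\<close> gives the symmetry of the matrix.\<close>
  have g_minus: "g (- c) = g c" for c by (simp add: g_def legendre_symbol_minus[OF q4])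
  have sym: "transpose_mat ?C = ?C"
    using car g_minus[of "a _ - a _"] by (intro eq_matI) (auto simp: entry)
  \<comment> \<open>This excludes k = 1, where the denominator k - 1 in the hypothesis on
    \<open>\<omega>\<^sub>0\<close> would vanish.\<close>
  have "q \<noteq> 1"
    using assms(1,3,4) prime_gt_1_nat[of p] by (auto simp: power_eq_1_iff)
  then have k: "k > 1" using assms(5,8) by presburger
  have norm: "?x\<^sup>2 + ?y\<^sup>2 = 1" using assms(9) by (simp add: cmod_def)
  have "?x\<^sup>2 - ?y\<^sup>2 = (2 - real_of_int k) / (real_of_int k - 1)"
    using assms(10) by (simp add: power2_eq_square)
  then have R: "(?x\<^sup>2 - ?y\<^sup>2) * (real_of_int k - 1) = 2 - real_of_int k"
    using k by (simp add: field_simps)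
  have "real q = 2 * real_of_int k - 1" using assms(8) by linarith
  \<comment> \<open>Since q = 2k - 1 and x^2 + y^2 = 1, the left side is (2k - 2) x^2 - 1, while
    \<open>R\<close> says (2 x^2 - 1)(k - 1) = 2 - k, that is, (2k - 2) x^2 = 1.\<close>
  have off: "(real q - 2) * ?x\<^sup>2 - ?y\<^sup>2 = 0"
  proof -
    have y: "?y\<^sup>2 = 1 - ?x\<^sup>2" using norm by simp
    show ?thesis using R unfolding y \<open>real q = _\<close> by (simp add: algebra_simps)
  qed
  have prod: "(?C * mat_adjoint ?C) $$ (i, j) = (if i = j then of_int (2 * k - 2) else 0)"
    if ij: "i < q" "j < q" for i j
  proof -
    have dim: "dim_row (mat_adjoint ?C) = q" "dim_col (mat_adjoint ?C) = q"
      using car by (auto simp: mat_adjoint_def)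
    have "(?C * mat_adjoint ?C) $$ (i, j) = (\<Sum>m = 0..<q. ?C $$ (i, m) * mat_adjoint ?C $$ (m, j))"
      using car ij dim by (simp add: scalar_prod_def)
    also have "\<dots> = (\<Sum>m = 0..<q. g (a i - a m) * cnj (g (a j - a m)))"
      using car ij by (intro sum.cong) (auto simp: mat_adjoint_index entry)
    also have "\<dots> = (\<Sum>c\<in>UNIV. g (a i - c) * cnj (g (a j - c)))"
      using assms(7) by (rule sum.reindex_bij_betw)
    also have "\<dots> = (\<Sum>c\<in>UNIV. g c * cnj (g (c + (a j - a i))))"
      by (intro sum.reindex_bij_witness[where i = "\<lambda>c. a i - c" and j = "\<lambda>c. a i - c"]) auto
    \<comment> \<open>Injectivity of \<open>a\<close> makes the shift zero exactly when i = j; the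
      diagonal value is then q - 1 = 2k - 2 by \<open>norm\<close>.\<close>
    also have "\<dots> = (if i = j then of_int (2 * k - 2) else 0)"
      using inj[of i j] ij off norm \<open>real q = _\<close> k
      unfolding g_def sum_legendre_rows[OF q4] assms(6)
      by (auto simp flip: of_real_power of_real_add)
    finally show ?thesis .
  qed
  have "?C * mat_adjoint ?C = of_int (2 * k - 2) \<cdot>\<^sub>m 1\<^sub>m q"
    using car prod by (intro eq_matI) (auto simp: mat_adjoint_def)
  then show ?thesis using car sym by (simp add: qk)
qed

end
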